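(* Let $\vec G$ be a strongly connected directed graph with vertices $v_0,\dots,v_n$. A $v_0$-sandpile configuration $D$ is $v_0$-recurrent if and only if the divisor $\nu$ is a $v_0$-reduced divisor, where $\nu(v_i)=\deg^+(v_i)-1-D(v_i)$ for all $0\le i\le n$.
   Context: Directed graphs are finite, without loops, possibly with multiple edges. $\deg^+(v)$ is the number of edges leaving $v$; the Laplacian is $\vec Q=\mathrm{diag}(\deg^+(v_0),\dots,\deg^+(v_n))-\vec A$, with $\vec A_{i,j}$ the number of edges from $v_i$ to $v_j$. $R=(r_0,\dots,r_n)$ is the vector of positive integers with $\gcd(r_0,\dots,r_n)=1$ and $\vec Q^TR=\vec 0$. Divisors are vectors in $\mathbb Z^{n+1}$ indexed by the vertices; inequalities are coordinatewise. Reduced divisors: a nonzero $f\in\mathbb Z^{n+1}$ is a valid firing strategy with respect to $v_0$ if $f(v_0)=0$ and $\vec0\le f\le R$. A divisor $\nu$ is $v_0$-reduced if $\nu(v)\ge0$ for all $v\ne v_0$ and for every valid firing strategy $f$ with respect to $v_0$ there is $v\ne v_0$ with $(\nu-\vec Q^Tf)(v)<0$. Sandpile model: a $v_0$-sandpile configuration is a divisor $D$ with $D(v)\ge0$ for all $v\ne v_0$; two configurations are regarded as the same if they agree at all vertices other than $v_0$. The vertex $v_0$ never fires; a vertex $v\ne v_0$ may fire only if it has at least $\deg^+(v)$ chips, in which case it sends one chip along each of its outgoing edges. A configuration is $v_0$-stable if no vertex $v\ne v_0$ can fire. A $v_0$-sandpile configuration stabilizes to a $v_0$-stable configuration $D$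 if $D$ is obtained from it by a sequence of such firings (the stabilization exists and is unique). A $v_0$-stable configuration $D$ is $v_0$-reachable from a $v_0$-sandpile configuration $D'$ if there is a divisor $E\ge\vec0$ such that $D'+E$ stabilizes to $D$; it is $v_0$-recurrent if it is $v_0$-reachable from every $v_0$-sandpile configuration. *)

theory Defs
  imports Complex_Main "Graph_Theory.Digraph" "Graph_Theory.Digraph_Component"
begin

text \<open>Divisors and firing strategies are functions on the vertex type; only their values on
  \<^term>\<open>verts G\<close> matter.\<close>

definition num_arcs :: "('a, 'b) pre_digraph \<Rightarrow> 'a \<Rightarrow> 'a \<Rightarrow> nat" where
  "num_arcs G u v = card {e \<in> arcs G. tail G e = u \<and> head G e = v}"

definition laplacian :: "('a, 'b) pre_digraph \<Rightarrow> 'a \<Rightarrow> 'a \<Rightarrow> int" where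
  "laplacian G u v = (if u = v then int (out_degree G u) else 0) - int (num_arcs G u v)"

definition laplacian_transpose_mult :: "('a, 'b) pre_digraph \<Rightarrow> ('a \<Rightarrow> int) \<Rightarrow> 'a \<Rightarrow> int" where
  "laplacian_transpose_mult G f v = (\<Sum>u\<in>verts G. laplacian G u v * f u)"

definition is_primitive_period :: "('a, 'b) pre_digraph \<Rightarrow> ('a \<Rightarrow> int) \<Rightarrow> bool" where
  "is_primitive_period G R \<longleftrightarrow>
     (\<forall>v\<in>verts G. 0 < R v) \<and> Gcd (R ` verts G) = 1 \<and>
     (\<forall>v\<in>verts G. laplacian_transpose_mult G R v = 0)"

text \<open>The vector \<open>R\<close>. A strongly connected finite digraph has exactly one primitive period on its
  vertices; the value 0 elsewhere makes it unique as a function on the whole type.\<close>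
definition primitive_period :: "('a, 'b) pre_digraph \<Rightarrow> 'a \<Rightarrow> int" where
  "primitive_period G = (THE R. is_primitive_period G R \<and> (\<forall>v. v \<notin> verts G \<longrightarrow> R v = 0))"

definition valid_firing_strategy :: "('a, 'b) pre_digraph \<Rightarrow> 'a \<Rightarrow> ('a \<Rightarrow> int) \<Rightarrow> bool" where
  "valid_firing_strategy G v0 f \<longleftrightarrow>
     (\<exists>v\<in>verts G. f v \<noteq> 0) \<and> f v0 = 0 \<and>
     (\<forall>v\<in>verts G. 0 \<le> f v \<and> f v \<le> primitive_period G v)"

definition reduced_divisor :: "('a, 'b) pre_digraph \<Rightarrow> 'a \<Rightarrow> ('a \<Rightarrow> int) \<Rightarrow> bool" where
  "reduced_divisor G v0 \<nu> \<longleftrightarrow>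
     (\<forall>v\<in>verts G - {v0}. 0 \<le> \<nu> v) \<and>
     (\<forall>f. valid_firing_strategy G v0 f \<longrightarrow>
        (\<exists>v\<in>verts G - {v0}. \<nu> v - laplacian_transpose_mult G f v < 0))"

definition sandpile_config :: "('a, 'b) pre_digraph \<Rightarrow> 'a \<Rightarrow> ('a \<Rightarrow> int) \<Rightarrow> bool" where
  "sandpile_config G v0 D \<longleftrightarrow> (\<forall>v\<in>verts G - {v0}. 0 \<le> D v)"

definition same_config :: "('a, 'b) pre_digraph \<Rightarrow> 'a \<Rightarrow> ('a \<Rightarrow> int) \<Rightarrow> ('a \<Rightarrow> int) \<Rightarrow> bool" where
  "same_config G v0 D D' \<longleftrightarrow> (\<forall>v\<in>verts G - {v0}. D v = D' v)"

definition can_fire :: "('a, 'b) pre_digraph \<Rightarrow> 'a \<Rightarrow> ('a \<Rightarrow> int) \<Rightarrow> 'a \<Rightarrow> bool" where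
  "can_fire G v0 D v \<longleftrightarrow> v \<in> verts G \<and> v \<noteq> v0 \<and> int (out_degree G v) \<le> D v"

definition fire_vertex :: "('a, 'b) pre_digraph \<Rightarrow> 'a \<Rightarrow> ('a \<Rightarrow> int) \<Rightarrow> 'a \<Rightarrow> int" where
  "fire_vertex G v D =
     (\<lambda>w. D w - (if w = v then int (out_degree G v) else 0) + int (num_arcs G v w))"

definition firing_step :: "('a, 'b) pre_digraph \<Rightarrow> 'a \<Rightarrow> ('a \<Rightarrow> int) \<Rightarrow> ('a \<Rightarrow> int) \<Rightarrow> bool" where
  "firing_step G v0 D D' \<longleftrightarrow> (\<exists>v. can_fire G v0 D v \<and> D' = fire_vertex G v D)"

definition stable_config :: "('a, 'b) pre_digraph \<Rightarrow> 'a \<Rightarrow> ('a \<Rightarrow> int) \<Rightarrow> bool" where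
  "stable_config G v0 D \<longleftrightarrow> sandpile_config G v0 D \<and> (\<forall>v. \<not> can_fire G v0 D v)"

definition stabilizes_to :: "('a, 'b) pre_digraph \<Rightarrow> 'a \<Rightarrow> ('a \<Rightarrow> int) \<Rightarrow> ('a \<Rightarrow> int) \<Rightarrow> bool" where
  "stabilizes_to G v0 C D \<longleftrightarrow>
     stable_config G v0 D \<and> (\<exists>S. (firing_step G v0)\<^sup>*\<^sup>* C S \<and> same_config G v0 S D)"

definition config_reachable_from ::
  "('a, 'b) pre_digraph \<Rightarrow> 'a \<Rightarrow> ('a \<Rightarrow> int) \<Rightarrow> ('a \<Rightarrow> int) \<Rightarrow> bool" where
  "config_reachable_from G v0 D D' \<longleftrightarrow>
     (\<exists>E. (\<forall>v\<in>verts G. 0 \<le> E v) \<and> stabilizes_to G v0 (\<lambda>v. D' v + E v) D)"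

definition recurrent_config :: "('a, 'b) pre_digraph \<Rightarrow> 'a \<Rightarrow> ('a \<Rightarrow> int) \<Rightarrow> bool" where
  "recurrent_config G v0 D \<longleftrightarrow>
     stable_config G v0 D \<and>
     (\<forall>D'. sandpile_config G v0 D' \<longrightarrow> config_reachable_from G v0 D D')"

end

theory Submission
  imports Defs
begin

text \<open>
  Write \<open>Q\<^sup>T\<close> for the transposed Laplacian. Replacing \<open>D\<close> by \<open>\<nu> = deg - 1 - D\<close> turns ``\<open>\<nu> - Q\<^sup>T f\<close> is negative
  somewhere off \<open>v\<^sub>0\<close>'' into ``\<open>D + Q\<^sup>T f\<close> is unstable''. By the least action principle, a legal
  firing sequence from \<open>X\<close> fires no vertex more often than any \<open>g \<ge> 0\<close> for which \<open>X - Q\<^sup>T g\<close> is stable.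

  If \<open>\<nu>\<close> is reduced, then \<open>D + Q\<^sup>T f\<close> is in fact unstable for every nonzero \<open>f \<ge> 0\<close> vanishing at \<open>v\<^sub>0\<close>.
  Given a configuration \<open>D'\<close>, choose \<open>F \<ge> 0\<close> vanishing at \<open>v\<^sub>0\<close> with \<open>X = D + Q\<^sup>T F \<ge> D'\<close> off \<open>v\<^sub>0\<close>. Legal firing
  from \<open>X\<close> ends in some \<open>D + Q\<^sup>T (F - u)\<close> with \<open>u \<le> F\<close>; as this is stable, \<open>u = F\<close>. Conversely, if \<open>D\<close> is
  recurrent and \<open>D + Q\<^sup>T f\<close> is stable, reach \<open>D\<close> from a configuration with so many chips that every
  vertex \<open>v\<close> fires \<open>u(v) \<ge> f(v)\<close> times. Since \<open>u - f\<close> is stabilizing too, \<open>u \<le> u - f\<close>, so \<open>f = 0\<close>.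
\<close>

section \<open>The transposed Laplacian\<close>

lemma laplacian_transpose_mult_add:
  "laplacian_transpose_mult G (\<lambda>v. f v + g v) w =
   laplacian_transpose_mult G f w + laplacian_transpose_mult G g w"
  by (simp add: laplacian_transpose_mult_def algebra_simps sum.distrib)

lemma laplacian_transpose_mult_diff:
  "laplacian_transpose_mult G (\<lambda>v. f v - g v) w =
   laplacian_transpose_mult G f w - laplacian_transpose_mult G g w"
  by (simp add: laplacian_transpose_mult_def algebra_simps sum_subtractf)

lemma laplacian_transpose_mult_scale:
  "laplacian_transpose_mult G (\<lambda>v. c * f v) w = c * laplacian_transpose_mult G f w"
  by (simp add: laplacian_transpose_mult_def algebra_simps sum_distrib_left)

lemma laplacian_transpose_mult_cong:
  "(\<And>v. v \<in> verts G \<Longrightarrow> f v = g v) \<Longrightarrow>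
   laplacian_transpose_mult G f w = laplacian_transpose_mult G g w"
  by (simp add: laplacian_transpose_mult_def)

lemmas laplacian_transpose_mult_linear =
  laplacian_transpose_mult_add laplacian_transpose_mult_diff laplacian_transpose_mult_scale

lemma fire_vertex_eq: "fire_vertex G v X = (\<lambda>w. X w - laplacian G v w)"
  by (auto simp: fire_vertex_def laplacian_def)

context fin_digraph
begin

abbreviation "QT \<equiv> laplacian_transpose_mult G"

lemma QT_indicator: "u \<in> verts G \<Longrightarrow> QT (\<lambda>v. of_bool (v = u)) w = laplacian G u w"
  by (simp add: laplacian_transpose_mult_def of_bool_def if_distrib cong: if_cong)

lemma QT_eq:
  assumes "w \<in> verts G"
  shows "QT f w = int (out_degree G w) * f w - (\<Sum>u\<in>verts G. int (num_arcs G u w) * f u)"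
proof -
  have "QT f w = (\<Sum>u\<in>verts G. (if u = w then int (out_degree G w) * f w else 0)
      - int (num_arcs G u w) * f u)"
    unfolding laplacian_transpose_mult_def
    by (intro sum.cong) (auto simp: laplacian_def algebra_simps)
  then show ?thesis
    using assms by (simp add: sum_subtractf)
qed

text \<open>The subtracted sum in \<open>QT_eq\<close> counts chips received, so each firing costs
  \<open>w\<close> at most its out-degree. This yields lower bounds on firing counts.\<close>

lemma QT_le_out_degree:
  assumes "w \<in> verts G" and "\<And>v. v \<in> verts G \<Longrightarrow> 0 \<le> f v"
  shows "QT f w \<le> int (out_degree G w) * f w"
  unfolding QT_eq[OF assms(1)] using assms(2) by (simp add: sum_nonneg)

lemma num_arcs_pos: "u \<rightarrow> v \<Longrightarrow> 0 < num_arcs G u v"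
  by (auto simp: num_arcs_def card_gt_0_iff arcs_ends_conv)

lemma sum_num_arcs: "(\<Sum>w\<in>verts G. num_arcs G u w) = out_degree G u"
proof -
  have "out_arcs G u = (\<Union>w\<in>verts G. {e \<in> arcs G. tail G e = u \<and> head G e = w})"
    by (auto simp: out_arcs_def)
  then show ?thesis
    unfolding out_degree_def num_arcs_def
    by (simp add: card_UN_disjoint disjoint_iff)
qed

lemma sum_laplacian: "u \<in> verts G \<Longrightarrow> (\<Sum>w\<in>verts G. laplacian G u w) = 0"
  unfolding laplacian_def
  by (simp add: sum_subtractf sum_num_arcs flip: of_nat_sum)

text \<open>Each row of the Laplacian sums to zero: firing conserves the total number of
  chips.\<close>

lemma sum_QT: "(\<Sum>w\<in>verts G. QT f w) = 0"
proof -
  have "(\<Sum>w\<in>verts G. QT f w) = (\<Sum>u\<in>verts G. (\<Sum>w\<in>verts G. laplacian G u w) * f u)"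
    unfolding laplacian_transpose_mult_def by (subst sum.swap) (simp add: sum_distrib_right)
  then show ?thesis by (simp add: sum_laplacian)
qed


section \<open>Existence and uniqueness of the primitive period\<close>

text \<open>Let every vertex fire, \<open>v\<^sub>0\<close> included, and start with as many chips as there are arcs.
  Then some vertex can always fire and the configuration stays in a finite set,
  so it recurs; the firings between two equal configurations form a period.\<close>
lemma ex_nonneg_period:
  assumes "verts G \<noteq> {}"
  shows "\<exists>f. (\<forall>v\<in>verts G. 0 \<le> f v) \<and> (\<exists>v\<in>verts G. 0 < f v) \<and> (\<forall>v\<in>verts G. QT f v = 0)"
proof -
  \<comment> \<open>\<open>C f\<close> is what remains when each \<open>v\<close> starts with one
    chip per outgoing arc and fires \<open>f v\<close> times.\<close>
  define C where "C f v = int (out_degree G v) - QT f v" for f v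
  define m where "m = (\<Sum>v\<in>verts G. int (out_degree G v))"
  have sum_C: "(\<Sum>v\<in>verts G. C f v) = m" for f
    by (simp add: C_def m_def sum_subtractf sum_QT)
  define P where "P n f \<longleftrightarrow> (\<forall>v\<in>verts G. 0 \<le> f v \<and> 0 \<le> C f v) \<and> sum f (verts G) = int n" for n f
  define St where "St f g \<longleftrightarrow> (\<exists>x\<in>verts G. g = (\<lambda>v. f v + of_bool (v = x)))"
    for f g :: "'a \<Rightarrow> int"
  have "\<exists>F. \<forall>n. P n (F n) \<and> St (F n) (F (Suc n))"
  proof (rule dependent_nat_choice)
    show "\<exists>f. P 0 f"
      by (rule exI[of _ "\<lambda>_. 0"]) (simp add: P_def C_def laplacian_transpose_mult_def)
  next
    fix f n assume P: "P n f"
    have "\<exists>x\<in>verts G. int (out_degree G x) \<le> C f x"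
    proof (rule ccontr)
      assume "\<not> ?thesis"
      then have "(\<Sum>v\<in>verts G. C f v) < m"
        unfolding m_def using assms by (intro sum_strict_mono) (auto simp: not_le)
      then show False using sum_C by simp
    qed
    then obtain x where x: "x \<in> verts G" "int (out_degree G x) \<le> C f x" by blast
    let ?g = "\<lambda>v. f v + of_bool (v = x)"
    have "C ?g v = C f v - laplacian G x v" for v
      using x(1) by (simp add: C_def laplacian_transpose_mult_add QT_indicator)
    then have "P (Suc n) ?g"
      using P x by (auto simp: P_def laplacian_def sum.distrib)
    then show "\<exists>g. P (Suc n) g \<and> St f g"
      using x(1) by (auto simp: St_def)
  qed
  then obtain F where F: "\<And>n. P n (F n)" and step: "\<And>n. St (F n) (F (Suc n))" by blast
  have mono: "F i v \<le> F j v" if "i \<le> j" for i j v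
    using that
  proof (induction j rule: dec_induct)
    case (step k)
    then show ?case using \<open>St (F k) (F (Suc k))\<close> by (force simp: St_def)
  qed simp
  \<comment> \<open>Cutting off the values outside \<open>verts G\<close> leaves only finitely many
    possible functions, so the pigeonhole principle applies.\<close>
  define R where "R n = restrict (C (F n)) (verts G)" for n
  have "R n \<in> (\<Pi>\<^sub>E v\<in>verts G. {0..m})" for n
  proof (intro PiE_I)
    fix v assume v: "v \<in> verts G"
    have "C (F n) v \<le> (\<Sum>v\<in>verts G. C (F n) v)"
      using F[of n] v by (intro member_le_sum) (auto simp: P_def)
    then show "R n v \<in> {0..m}"
      using F[of n] v by (auto simp: P_def R_def sum_C)
  qed (simp add: R_def)
  then have "finite (range R)"
    by (intro finite_subset[OF _ finite_PiE[of "verts G" "\<lambda>_. {0..m}"]]) auto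
  then have "\<not> inj R"
    using finite_imageD[of R UNIV] by auto
  then obtain i j where ij: "i < j" "R i = R j"
    unfolding inj_def by (metis linorder_neqE_nat)
  let ?f = "\<lambda>v. F j v - F i v"
  have "QT ?f v = 0" if "v \<in> verts G" for v
    using fun_cong[OF ij(2), of v] that by (simp add: R_def C_def laplacian_transpose_mult_diff)
  moreover have nonneg: "0 \<le> ?f v" for v
    using mono[of i j v] ij(1) by simp
  moreover have "0 < sum ?f (verts G)"
    using F[of i] F[of j] ij(1) by (simp add: P_def sum_subtractf)
  then have "\<exists>v\<in>verts G. 0 < ?f v"
    using sum_nonpos[of "verts G" ?f] by (meson not_le)
  ultimately show ?thesis by (intro exI[of _ ?f]) auto
qed

text \<open>Positivity spreads along arcs: in a period the chips \<open>y\<close> sends out equal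
  those it receives, and an arc from \<open>x\<close> with \<open>f x\<close> positive makes the
  latter positive.\<close>

lemma nonneg_period_pos:
  assumes sc: "strongly_connected G"
    and nonneg: "\<And>v. v \<in> verts G \<Longrightarrow> 0 \<le> f v"
    and period: "\<And>v. v \<in> verts G \<Longrightarrow> QT f v = 0"
    and u: "u \<in> verts G" "0 < f u" and w: "w \<in> verts G"
  shows "0 < f w"
proof -
  have "u \<rightarrow>\<^sup>* w" using sc u(1) w by auto
  then show ?thesis
  proof (induction rule: reachable_induct)
    case base
    show ?case by fact
  next
    case (step x y)
    then have xy: "x \<in> verts G" "y \<in> verts G" by auto
    have "0 < int (num_arcs G x y) * f x"
      using num_arcs_pos[OF step(2)] step(3) by simp
    also have "\<dots> \<le> (\<Sum>u\<in>verts G. int (num_arcs G u y) * f u)"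
      using xy nonneg by (intro member_le_sum) auto
    also have "\<dots> = int (out_degree G y) * f y"
      using period[OF xy(2)] QT_eq[OF xy(2), of f] by simp
    finally show ?case
      by (simp add: zero_less_mult_iff)
  qed
qed

lemma ex_primitive_period:
  assumes sc: "strongly_connected G"
  shows "\<exists>R. is_primitive_period G R"
proof -
  have ne: "verts G \<noteq> {}" using sc by (simp add: strongly_connected_def)
  obtain f u where f: "\<forall>v\<in>verts G. 0 \<le> f v" "\<forall>v\<in>verts G. QT f v = 0"
    and u: "u \<in> verts G" "0 < f u"
    using ex_nonneg_period[OF ne] by blast
  have pos: "0 < f v" if "v \<in> verts G" for v
    by (rule nonneg_period_pos[of f u v]) (use sc f u that in auto)
  define d where "d = Gcd (f ` verts G)"
  have dvd: "d dvd f v" if "v \<in> verts G" for v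
    using that by (simp add: d_def Gcd_dvd)
  have "d \<noteq> 0" using dvd[OF u(1)] u(2) by auto
  then have d: "0 < d"
    using Gcd_int_greater_eq_0[of "f ` verts G"] unfolding d_def by linarith
  define R where "R v = f v div d" for v
  have fR: "f v = d * R v" if "v \<in> verts G" for v
    using dvd[OF that] by (simp add: R_def)
  have "d = Gcd ((*) d ` R ` verts G)"
    unfolding d_def image_image using fR by (intro arg_cong[where f = Gcd]) (auto simp: d_def)
  also have "\<dots> = d * Gcd (R ` verts G)"
    using d by (simp add: Gcd_mult)
  finally have "Gcd (R ` verts G) = 1" using d by simp
  moreover have "QT R v = 0" if "v \<in> verts G" for v
  proof -
    have "d * QT R v = QT f v"
      unfolding laplacian_transpose_mult_scale[symmetric]
      by (rule laplacian_transpose_mult_cong) (simp add: fR)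
    then show ?thesis using f(2) that d by simp
  qed
  moreover have "0 < R v" if "v \<in> verts G" for v
    using pos[OF that] fR[OF that] d by (simp add: zero_less_mult_iff)
  ultimately show ?thesis
    unfolding is_primitive_period_def by blast
qed

text \<open>Subtracting multiples chosen at a vertex of minimal ratio gives a nonnegative period
  with a zero, which must vanish. So \<open>R\<close> and \<open>S\<close> are proportional, and gcd
  1 fixes the factor.\<close>

lemma primitive_period_unique:
  assumes sc: "strongly_connected G"
    and R: "is_primitive_period G R" and S: "is_primitive_period G S" and w: "w \<in> verts G"
  shows "R w = S w"
proof -
  have ne: "verts G \<noteq> {}" using w by blast
  have Rpos: "0 < R v" and Spos: "0 < S v" if "v \<in> verts G" for v
    using R S that by (auto simp: is_primitive_period_def)
  define q where "q v = of_int (S v) / (of_int (R v) :: rat)" for v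
  obtain x where x: "x \<in> verts G" and min: "\<And>v. v \<in> verts G \<Longrightarrow> q x \<le> q v"
    using ex_min_if_finite[of "q ` verts G"] ne by (force simp: not_less)
  let ?g = "\<lambda>v. R x * S v - S x * R v"
  have nonneg: "0 \<le> ?g v" if "v \<in> verts G" for v
  proof -
    have "of_int (S x * R v) \<le> (of_int (R x * S v) :: rat)"
      using min[OF that] Rpos[OF x] Rpos[OF that] by (simp add: q_def field_simps)
    then show ?thesis by (simp only: of_int_le_iff)
  qed
  have "QT ?g v = 0" if "v \<in> verts G" for v
    using R S that by (simp add: is_primitive_period_def laplacian_transpose_mult_linear)
  then have "\<not> 0 < ?g v" if "v \<in> verts G" for v
    using nonneg_period_pos[where f = ?g and u = v and w = x] sc nonneg that x by auto
  then have proportional: "R x * S v = S x * R v" if "v \<in> verts G" for v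
    using nonneg[OF that] that by force
  have "R x * Gcd (S ` verts G) = Gcd ((*) (R x) ` S ` verts G)"
    using Rpos[OF x] by (simp add: Gcd_mult)
  also have "\<dots> = Gcd ((*) (S x) ` R ` verts G)"
    using proportional by (intro arg_cong[where f = Gcd]) (auto simp: image_image)
  also have "\<dots> = S x * Gcd (R ` verts G)"
    using Spos[OF x] by (simp add: Gcd_mult)
  finally have "R x = S x"
    using R S by (simp add: is_primitive_period_def)
  then show ?thesis using proportional[OF w] Rpos[OF x] by simp
qed

text \<open>Existence and uniqueness justify the definite description; extending by 0 makes
  uniqueness hold for whole functions.\<close>

lemma is_primitive_period_primitive_period:
  assumes sc: "strongly_connected G"
  shows "is_primitive_period G (primitive_period G)"
proof -
  let ?P = "\<lambda>R. is_primitive_period G R \<and> (\<forall>v. v \<notin> verts G \<longrightarrow> R v = 0)"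
  obtain S where S: "is_primitive_period G S"
    using ex_primitive_period[OF sc] by blast
  let ?R = "\<lambda>v. if v \<in> verts G then S v else 0"
  have "?P ?R"
    using S laplacian_transpose_mult_cong[of G ?R S]
    by (auto simp: is_primitive_period_def)
  moreover have "R = R'" if "?P R" "?P R'" for R R'
  proof
    fix v show "R v = R' v"
      using that primitive_period_unique[OF sc, of R R' v] by (cases "v \<in> verts G") auto
  qed
  ultimately have "\<exists>!R. ?P R" by blast
  then have "?P (primitive_period G)"
    unfolding primitive_period_def by (rule theI')
  then show ?thesis by blast
qed


section \<open>Firing sequences and stabilization\<close>

text \<open>A vector of firing counts with no legal order attached, the competitor in the least
  action principle.\<close>

definition stabilizing :: "'a \<Rightarrow> ('a \<Rightarrow> int) \<Rightarrow> ('a \<Rightarrow> int) \<Rightarrow> bool" where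
  "stabilizing v0 X g \<longleftrightarrow>
     (\<forall>v\<in>verts G. 0 \<le> g v) \<and> (\<forall>v\<in>verts G - {v0}. X v - QT g v < int (out_degree G v))"

text \<open>The vertex \<open>x\<close> is unstable before \<open>g\<close> is applied and stable
  after, so \<open>g\<close> must fire it. Performing one of these firings first leaves the outcome
  unchanged.\<close>

lemma stabilizing_fire:
  assumes "stabilizing v0 X g" and "can_fire G v0 X x"
  shows "1 \<le> g x" and "stabilizing v0 (fire_vertex G x X) (\<lambda>v. g v - of_bool (v = x))"
proof -
  have x: "x \<in> verts G" "x \<noteq> v0" "int (out_degree G x) \<le> X x"
    using assms(2) by (auto simp: can_fire_def)
  have "0 < QT g x"
    using assms(1) x by (force simp: stabilizing_def)
  also have "\<dots> \<le> int (out_degree G x) * g x"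
    using assms(1) x(1) by (intro QT_le_out_degree) (auto simp: stabilizing_def)
  finally show g: "1 \<le> g x"
    by (simp add: zero_less_mult_iff)
  show "stabilizing v0 (fire_vertex G x X) (\<lambda>v. g v - of_bool (v = x))"
    using assms(1) g x(1)
    by (auto simp: stabilizing_def fire_vertex_eq laplacian_transpose_mult_diff QT_indicator)
qed

text \<open>Induction from the front of the sequence: every stabilizing \<open>g\<close> contains
  the first firing, which can be removed from both sides.\<close>

lemma firing_sequence_least_action:
  assumes "(firing_step G v0)\<^sup>*\<^sup>* X S"
  shows "\<exists>u. u v0 = 0 \<and> (\<forall>v. 0 \<le> u v) \<and> S = (\<lambda>v. X v - QT u v) \<and>
    (\<forall>g. stabilizing v0 X g \<longrightarrow> (\<forall>v\<in>verts G. u v \<le> g v))"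
  using assms
proof (induction rule: converse_rtranclp_induct)
  case base
  show ?case
    by (rule exI[of _ "\<lambda>_. 0"]) (auto simp: stabilizing_def laplacian_transpose_mult_def)
next
  case (step X Y)
  obtain x where x: "can_fire G v0 X x" and Y: "Y = fire_vertex G x X"
    using step(1) by (auto simp: firing_step_def)
  obtain u where u: "u v0 = 0" "\<And>v. 0 \<le> u v" "S = (\<lambda>v. Y v - QT u v)"
    and least: "\<And>g v. stabilizing v0 Y g \<Longrightarrow> v \<in> verts G \<Longrightarrow> u v \<le> g v"
    using step(3) by blast
  have xG: "x \<in> verts G" "x \<noteq> v0" using x by (auto simp: can_fire_def)
  show ?case
  proof (intro exI[of _ "\<lambda>v. u v + of_bool (v = x)"] conjI allI impI ballI)
    fix g v assume "stabilizing v0 X g" "v \<in> verts G"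
    then show "u v + of_bool (v = x) \<le> g v"
      using least stabilizing_fire(2)[OF _ x] unfolding Y by fastforce
  qed (use u xG in \<open>auto simp: Y fire_vertex_eq laplacian_transpose_mult_add QT_indicator\<close>)
qed

text \<open>\<open>F\<close> is a budget: each legal firing uses up one unit of its total, so firing
  terminates.\<close>

lemma ex_stabilization:
  assumes "stabilizing v0 X F"
  shows "\<exists>S. (firing_step G v0)\<^sup>*\<^sup>* X S \<and> (\<forall>v. \<not> can_fire G v0 S v)"
  using assms
proof (induction "nat (sum F (verts G))" arbitrary: X F rule: less_induct)
  case less
  show ?case
  proof (cases "\<exists>x. can_fire G v0 X x")
    case True
    then obtain x where x: "can_fire G v0 X x" by blast
    let ?F = "\<lambda>v. F v - of_bool (v = x)"
    have xG: "x \<in> verts G" using x by (auto simp: can_fire_def)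
    have nonneg: "\<And>v. v \<in> verts G \<Longrightarrow> 0 \<le> F v"
      using less(2) by (auto simp: stabilizing_def)
    have "1 \<le> F x" by (rule stabilizing_fire(1)[OF less(2) x])
    also have "\<dots> \<le> sum F (verts G)"
      using xG nonneg by (intro member_le_sum) auto
    finally have "nat (sum ?F (verts G)) < nat (sum F (verts G))"
      using xG by (simp add: sum_subtractf)
    from less(1)[OF this stabilizing_fire(2)[OF less(2) x]] obtain S
      where S: "(firing_step G v0)\<^sup>*\<^sup>* (fire_vertex G x X) S" "\<forall>v. \<not> can_fire G v0 S v"
      by blast
    have "firing_step G v0 X (fire_vertex G x X)"
      using x by (auto simp: firing_step_def)
    then show ?thesis using S by (meson converse_rtranclp_into_rtranclp)
  qed blast
qed


section \<open>Large divisors in the image of the transposed Laplacian\<close>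

text \<open>Induction along a path from \<open>v0\<close>, where subtracting
  \<open>of_bool (v = x)\<close> sends chips from \<open>x\<close> to its successors.\<close>

lemma ex_superharmonic_at:
  assumes sc: "strongly_connected G" and v0: "v0 \<in> verts G" and w: "w \<in> verts G" "w \<noteq> v0"
  shows "\<exists>F. F v0 = 0 \<and> (\<forall>v\<in>verts G. 0 \<le> F v) \<and> (\<forall>v\<in>verts G - {v0}. 0 \<le> QT F v) \<and> 0 < QT F w"
proof -
  have "v0 \<rightarrow>\<^sup>* w" using sc v0 w by auto
  then have "w \<noteq> v0 \<longrightarrow> (\<exists>F. F v0 = 0 \<and> (\<forall>v\<in>verts G. 0 \<le> F v) \<and>
    (\<forall>v\<in>verts G - {v0}. 0 \<le> QT F v) \<and> 0 < QT F w)"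
  proof (induction rule: reachable_induct)
    case (step x y)
    then have xy: "x \<in> verts G" "y \<in> verts G" by auto
    have arc: "0 < num_arcs G x y" by (rule num_arcs_pos[OF step(2)])
    show ?case
    proof (cases "x = v0")
      case True
      let ?R = "primitive_period G"
      \<comment> \<open>The period without its firings of \<open>v0\<close>: off \<open>v0\<close>
        its image is exactly the chips that \<open>v0\<close> would have sent.\<close>
      let ?F = "\<lambda>v. ?R v - ?R v0 * of_bool (v = v0)"
      have R: "\<And>v. v \<in> verts G \<Longrightarrow> 0 < ?R v" "\<And>v. v \<in> verts G \<Longrightarrow> QT ?R v = 0"
        using is_primitive_period_primitive_period[OF sc] by (auto simp: is_primitive_period_def)
      have QT: "QT ?F v = ?R v0 * int (num_arcs G v0 v)" if "v \<in> verts G" "v \<noteq> v0" for v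
        using R(2)[OF that(1)] that v0
        by (simp add: laplacian_transpose_mult_diff
            laplacian_transpose_mult_scale[of G _ "\<lambda>v. of_bool (v = v0)"] QT_indicator laplacian_def)
      show ?thesis
        using QT R(1) v0 xy arc True
        by (intro impI exI[of _ ?F]) (auto simp: less_imp_le)
    next
      case False
      then obtain F where F: "F v0 = 0" "\<forall>v\<in>verts G. 0 \<le> F v"
        "\<forall>v\<in>verts G - {v0}. 0 \<le> QT F v" "0 < QT F x"
        using step(3) by blast
      \<comment> \<open>As \<open>QT F x\<close> is at least 1, this factor leaves \<open>x\<close>
        at least one chip after paying its out-degree.\<close>
      let ?N = "int (out_degree G x) + 1"
      let ?F = "\<lambda>v. ?N * F v - of_bool (v = x)"
      have "0 < int (out_degree G x) * F x"
        using F(2,4) QT_le_out_degree[OF xy(1), of F] by fastforce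
      then have "0 < ?N * F x" by (simp add: zero_less_mult_iff)
      moreover have "0 \<le> ?N * F v" if "v \<in> verts G" for v
        using F(2) that by simp
      ultimately have nonneg: "\<forall>v\<in>verts G. 0 \<le> ?F v"
        by (simp add: of_bool_def)
      have QT: "QT ?F v = ?N * QT F v - laplacian G x v" for v
        using xy by (simp add: laplacian_transpose_mult_linear QT_indicator)
      have "0 \<le> int (out_degree G x) * (QT F x - 1)"
        using F(4) by simp
      moreover have "QT ?F x = int (out_degree G x) * (QT F x - 1) + QT F x + int (num_arcs G x x)"
        unfolding QT by (simp add: laplacian_def algebra_simps)
      ultimately have x: "0 < QT ?F x" using F(4) by linarith
      have other: "QT ?F v = ?N * QT F v + int (num_arcs G x v)" if "v \<noteq> x" for v
        using that by (simp add: QT laplacian_def)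
      have Q_nonneg: "\<forall>v\<in>verts G - {v0}. 0 \<le> QT ?F v"
      proof
        fix v assume v: "v \<in> verts G - {v0}"
        show "0 \<le> QT ?F v"
        proof (cases "v = x")
          case True
          then show ?thesis using x by simp
        next
          case False
          have "0 \<le> ?N * QT F v" using F(3) v by simp
          then show ?thesis using other[OF False] by simp
        qed
      qed
      have "0 < QT ?F y" if "y \<noteq> v0"
      proof (cases "y = x")
        case True
        then show ?thesis using x by simp
      next
        case neq: False
        have "0 \<le> ?N * QT F y" using F(3) xy that by simp
        then show ?thesis using other[OF neq] arc by simp
      qed
      then show ?thesis
        using nonneg Q_nonneg F(1) False by (intro impI exI[of _ ?F]) auto
    qed
  qed simp
  then show ?thesis using w(2) by blast
qed

text \<open>The vectors for single targets are added up; none of them spoils positivity gained by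
  another.\<close>

lemma ex_superharmonic:
  assumes sc: "strongly_connected G" and v0: "v0 \<in> verts G"
  shows "\<exists>F. F v0 = 0 \<and> (\<forall>v\<in>verts G. 0 \<le> F v) \<and> (\<forall>v\<in>verts G - {v0}. 0 < QT F v)"
proof -
  have "W \<subseteq> verts G - {v0} \<Longrightarrow> \<exists>F. F v0 = 0 \<and> (\<forall>v\<in>verts G. 0 \<le> F v) \<and>
    (\<forall>v\<in>verts G - {v0}. 0 \<le> QT F v) \<and> (\<forall>v\<in>W. 0 < QT F v)" if "finite W" for W
    using that
  proof (induction W rule: finite_induct)
    case empty
    show ?case
      by (rule exI[of _ "\<lambda>_. 0"]) (simp add: laplacian_transpose_mult_def)
  next
    case (insert w W)
    obtain F where F: "F v0 = 0" "\<forall>v\<in>verts G. 0 \<le> F v" "\<forall>v\<in>verts G - {v0}. 0 \<le> QT F v"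
      "\<forall>v\<in>W. 0 < QT F v"
      using insert by blast
    obtain H where H: "H v0 = 0" "\<forall>v\<in>verts G. 0 \<le> H v" "\<forall>v\<in>verts G - {v0}. 0 \<le> QT H v"
      "0 < QT H w"
      using ex_superharmonic_at[OF sc v0, of w] insert by blast
    show ?case
      using F H insert.prems
      by (intro exI[of _ "\<lambda>v. F v + H v"])
        (auto simp: laplacian_transpose_mult_add add_pos_nonneg add_nonneg_pos subset_iff)
  qed
  from this[of "verts G - {v0}"] show ?thesis by auto
qed

lemma ex_large_QT:
  assumes sc: "strongly_connected G" and v0: "v0 \<in> verts G"
  shows "\<exists>F. F v0 = 0 \<and> (\<forall>v\<in>verts G. 0 \<le> F v) \<and> (\<forall>v\<in>verts G - {v0}. B v \<le> QT F v)"
proof -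
  obtain F where F: "F v0 = 0" "\<forall>v\<in>verts G. 0 \<le> F v" "\<forall>v\<in>verts G - {v0}. 0 < QT F v"
    using ex_superharmonic[OF sc v0] by blast
  define N where "N = (\<Sum>v\<in>verts G. \<bar>B v\<bar>)"
  have N: "0 \<le> N" by (simp add: N_def sum_nonneg)
  have "B v \<le> N * QT F v" if v: "v \<in> verts G - {v0}" for v
  proof -
    have "\<bar>B v\<bar> \<le> N"
      unfolding N_def using v by (intro member_le_sum) auto
    moreover have "N * 1 \<le> N * QT F v"
      using F(3) v N by (intro mult_left_mono) force+
    ultimately show ?thesis by linarith
  qed
  then show ?thesis
    using F(1,2) N by (intro exI[of _ "\<lambda>v. N * F v"]) (simp add: laplacian_transpose_mult_scale)
qed


section \<open>Reduced divisors and recurrent configurations\<close>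

text \<open>If \<open>K\<close> is the least number with \<open>f \<le> K R\<close>, then the positive part of \<open>f - (K - 1) R\<close> is
  a valid firing strategy: where it vanishes it only adds chips to \<open>\<nu>\<close>, elsewhere it leaves
  at least as many as \<open>f\<close> does.\<close>
lemma reduced_divisorD:
  assumes sc: "strongly_connected G" and v0: "v0 \<in> verts G"
    and red: "reduced_divisor G v0 \<nu>"
    and f: "\<And>v. v \<in> verts G \<Longrightarrow> 0 \<le> f v" "f v0 = 0" "\<exists>v\<in>verts G. f v \<noteq> 0"
  shows "\<exists>v\<in>verts G - {v0}. \<nu> v - QT f v < 0"
proof -
  let ?R = "primitive_period G"
  have R: "\<And>v. v \<in> verts G \<Longrightarrow> 0 < ?R v" "\<And>v. v \<in> verts G \<Longrightarrow> QT ?R v = 0"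
    using is_primitive_period_primitive_period[OF sc] by (auto simp: is_primitive_period_def)
  define A where "A k \<longleftrightarrow> (\<forall>v\<in>verts G. f v \<le> int k * ?R v)" for k
  define M where "M = nat (sum f (verts G))"
  have "A M"
    unfolding A_def
  proof
    fix v assume v: "v \<in> verts G"
    have "f v \<le> int M"
      unfolding M_def using f(1) v member_le_sum[of v "verts G" f] by (simp add: sum_nonneg)
    also have "int M * 1 \<le> int M * ?R v"
      using R(1)[OF v] by (intro mult_left_mono) auto
    finally show "f v \<le> int M * ?R v" by simp
  qed
  define K where "K = (LEAST k. A k)"
  have AK: "A K" unfolding K_def using \<open>A M\<close> by (rule LeastI)
  \<comment> \<open>Since \<open>f\<close> is nonzero, \<open>K\<close> is positive and
    \<open>k\<close> is the \<open>K - 1\<close> of the description above.\<close>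
  have "\<not> A 0" using f(1,3) by (force simp: A_def)
  then obtain k where k: "K = Suc k" using AK by (cases K) auto
  then have nAk: "\<not> A k" using not_less_Least[of k A] by (simp add: K_def)
  define h where "h v = f v - int k * ?R v" for v
  define g where "g v = max (h v) 0" for v
  have "valid_firing_strategy G v0 g"
    unfolding valid_firing_strategy_def
  proof (intro conjI ballI)
    show "\<exists>v\<in>verts G. g v \<noteq> 0"
      using nAk by (force simp: A_def g_def h_def)
    show "g v0 = 0"
      using f(2) R(1)[OF v0] by (simp add: g_def h_def)
    fix v assume v: "v \<in> verts G"
    show "0 \<le> g v" by (simp add: g_def)
    show "g v \<le> ?R v"
      using AK v R(1)[OF v] by (auto simp: A_def k g_def h_def algebra_simps)
  qed
  then obtain v where v: "v \<in> verts G" "v \<noteq> v0" and neg: "\<nu> v - QT g v < 0"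
    using red by (auto simp: reduced_divisor_def)
  have "0 < h v"
  proof (rule ccontr)
    assume "\<not> 0 < h v"
    then have "g v = 0" by (simp add: g_def)
    then have "QT g v \<le> 0"
      using QT_le_out_degree[OF v(1), of g] by (simp add: g_def)
    then show False
      using neg red v by (force simp: reduced_divisor_def)
  qed
  then have "g v = h v" by (simp add: g_def)
  moreover have "(\<Sum>u\<in>verts G. int (num_arcs G u v) * h u) \<le> (\<Sum>u\<in>verts G. int (num_arcs G u v) * g u)"
    by (intro sum_mono mult_left_mono) (auto simp: g_def)
  ultimately have "QT g v \<le> QT h v"
    by (simp add: QT_eq[OF v(1)])
  also have "\<dots> = QT f v"
    using R(2)[OF v(1)] unfolding h_def by (simp add: laplacian_transpose_mult_linear)
  finally show ?thesis using neg v by force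
qed

lemma recurrent_config_if_reduced_divisor:
  assumes sc: "strongly_connected G" and v0: "v0 \<in> verts G" and D: "sandpile_config G v0 D"
    and red: "reduced_divisor G v0 (\<lambda>v. int (out_degree G v) - 1 - D v)"
  shows "recurrent_config G v0 D"
  unfolding recurrent_config_def
proof (intro conjI allI impI)
  show stable: "stable_config G v0 D"
    using D red by (force simp: stable_config_def can_fire_def reduced_divisor_def)
  fix D'
  obtain F where F: "F v0 = 0" "\<forall>v\<in>verts G. 0 \<le> F v"
    "\<forall>v\<in>verts G - {v0}. D' v - D v \<le> QT F v"
    using ex_large_QT[OF sc v0, of "\<lambda>v. D' v - D v"] by blast
  \<comment> \<open>\<open>E\<close> lifts \<open>D'\<close> to \<open>D + QT F\<close> off
    \<open>v0\<close>; the value at \<open>v0\<close> does not affect which vertices may fire, so 0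
    is enough.\<close>
  define E where "E v = (if v = v0 then 0 else D v + QT F v - D' v)" for v
  define X where "X v = D' v + E v" for v
  have X: "X v = D v + QT F v" if "v \<noteq> v0" for v
    using that by (simp add: X_def E_def)
  have "stabilizing v0 X F"
    using F(2) X stable by (force simp: stabilizing_def stable_config_def can_fire_def)
  then obtain S where S: "(firing_step G v0)\<^sup>*\<^sup>* X S" "\<forall>v. \<not> can_fire G v0 S v"
    using ex_stabilization by blast
  obtain u where u: "u v0 = 0" "S = (\<lambda>v. X v - QT u v)" "\<forall>v\<in>verts G. u v \<le> F v"
    using firing_sequence_least_action[OF S(1)] \<open>stabilizing v0 X F\<close> by blast
  let ?f = "\<lambda>v. F v - u v"
  have SD: "S v = D v + QT ?f v" if "v \<noteq> v0" for v
    using that by (simp add: u(2) X laplacian_transpose_mult_diff)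
  have "\<forall>v\<in>verts G. ?f v = 0"
  proof (rule ccontr)
    assume "\<not> ?thesis"
    then have "\<exists>v\<in>verts G - {v0}. int (out_degree G v) - 1 - D v - QT ?f v < 0"
      using u(1,3) F(1) by (intro reduced_divisorD[OF sc v0 red]) auto
    then show False
      using S(2) SD by (force simp: can_fire_def)
  qed
  then have "QT ?f v = 0" for v
    by (simp add: laplacian_transpose_mult_def)
  then have "same_config G v0 S D"
    using SD by (simp add: same_config_def)
  then have "stabilizes_to G v0 (\<lambda>v. D' v + E v) D"
    using stable S(1) unfolding stabilizes_to_def X_def by blast
  moreover have "\<forall>v\<in>verts G. 0 \<le> E v"
    using F(3) by (simp add: E_def algebra_simps)
  ultimately show "config_reachable_from G v0 D D'"
    unfolding config_reachable_from_def by blast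
qed

lemma reduced_divisor_if_recurrent_config:
  assumes rec: "recurrent_config G v0 D"
  shows "reduced_divisor G v0 (\<lambda>v. int (out_degree G v) - 1 - D v)"
  unfolding reduced_divisor_def
proof (intro conjI allI impI)
  have stable: "0 \<le> D v" "D v < int (out_degree G v)" if "v \<in> verts G - {v0}" for v
    using rec that
    by (auto simp: recurrent_config_def stable_config_def sandpile_config_def can_fire_def not_le)
  show "\<forall>v\<in>verts G - {v0}. 0 \<le> int (out_degree G v) - 1 - D v"
    using stable by force
  fix f assume "valid_firing_strategy G v0 f"
  then have f: "f v0 = 0" "\<And>v. v \<in> verts G \<Longrightarrow> 0 \<le> f v" "\<exists>v\<in>verts G. f v \<noteq> 0"
    by (auto simp: valid_firing_strategy_def)
  show "\<exists>v\<in>verts G - {v0}. int (out_degree G v) - 1 - D v - QT f v < 0"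
  proof (rule ccontr)
    assume "\<not> ?thesis"
    then have f_stable: "D v + QT f v < int (out_degree G v)" if "v \<in> verts G - {v0}" for v
      using that by force
    \<comment> \<open>The surplus at \<open>v\<close> is the cost of \<open>f v\<close> firings, so
      returning to \<open>D\<close> forces at least that many.\<close>
    define D' where "D' v = D v + int (out_degree G v) * f v" for v
    have "sandpile_config G v0 D'"
      using stable f(2) by (auto simp: sandpile_config_def D'_def)
    then obtain E S where E: "\<forall>v\<in>verts G. 0 \<le> E v"
      and S: "(firing_step G v0)\<^sup>*\<^sup>* (\<lambda>v. D' v + E v) S" "same_config G v0 S D"
      using rec unfolding recurrent_config_def config_reachable_from_def stabilizes_to_def by blast
    define X where "X v = D' v + E v" for v
    obtain u where u: "u v0 = 0" "\<forall>v. 0 \<le> u v" "S = (\<lambda>v. X v - QT u v)"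
      and least: "\<forall>g. stabilizing v0 X g \<longrightarrow> (\<forall>v\<in>verts G. u v \<le> g v)"
      using firing_sequence_least_action[OF S(1)] unfolding X_def by blast
    have D_eq: "D v = X v - QT u v" if "v \<in> verts G - {v0}" for v
      using S(2) that by (simp add: same_config_def u(3))
    have le: "f v \<le> u v" if "v \<in> verts G" for v
    proof (cases "v = v0")
      case False
      then have v: "v \<in> verts G - {v0}" using that by simp
      have "int (out_degree G v) * f v \<le> QT u v"
        using D_eq[OF v] bspec[OF E that] unfolding X_def D'_def by linarith
      also have "\<dots> \<le> int (out_degree G v) * u v"
        using u(2) by (intro QT_le_out_degree[OF that]) auto
      \<comment> \<open>The bounds \<open>0 \<le> D v < out_degree G v\<close> make the out-degree
        positive, so it can be cancelled.\<close>
      finally show ?thesis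
        using stable[OF v] by (simp add: mult_le_cancel_left)
    qed (simp add: f(1) u(1))
    \<comment> \<open>Leaving out \<open>f\<close> ends at \<open>D + QT f\<close> off
      \<open>v0\<close>, stable by assumption.\<close>
    have "stabilizing v0 X (\<lambda>v. u v - f v)"
      unfolding stabilizing_def
    proof (intro conjI ballI)
      fix v assume v: "v \<in> verts G - {v0}"
      show "X v - QT (\<lambda>v. u v - f v) v < int (out_degree G v)"
        using f_stable[OF v] D_eq[OF v] by (simp add: laplacian_transpose_mult_diff)
    qed (simp add: le)
    then have "f v \<le> 0" if "v \<in> verts G" for v
      using least that by force
    then show False using f(2,3) by (meson order_antisym)
  qed
qed

end

theorem theorem3p15:
  fixes G :: "('a, 'b) pre_digraph" and v0 :: 'a and D :: "'a \<Rightarrow> int"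
  assumes "fin_digraph G" and "loopfree_digraph G" and "strongly_connected G"
    and "v0 \<in> verts G"
    and "sandpile_config G v0 D"
  shows "recurrent_config G v0 D \<longleftrightarrow>
    reduced_divisor G v0 (\<lambda>v. int (out_degree G v) - 1 - D v)"
proof -
  interpret fin_digraph G by fact
  show ?thesis
    using recurrent_config_if_reduced_divisor[OF assms(3-5)] reduced_divisor_if_recurrent_config
    by blast
qed

end
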